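(* Let $n\ge 1$ and $r\ge 0$ be integers, let $s\ge 1$ be an integer, and let $X$ be an indeterminate. Then \[ \sum_{\mu\vdash n} c_r(\mu)\,\frac{X^{l(\mu)-1}}{z_\mu}\sum_{i=1}^{l(\mu)} (\mu_i)_s \;=\;(s-1)!\binom{n+s-1}{n-r}\left[\binom{X+r+s-1}{r}-\binom{X+r-1}{r}\right], \] where the sum on the left runs over all partitions $\mu=(\mu_1,\dots,\mu_{l(\mu)})$ of $n$, and the identity holds as polynomials in $X$.
   Context: For a number $a$ and an integer $k\ge 0$, $(a)_k=a(a+1)\cdots(a+k-1)$ denotes the rising factorial. For a partition $\mu$ of $n$, $l(\mu)$ is the number of (nonzero) parts of $\mu$, $m_i(\mu)$ is the number of parts equal to $i$, and $z_\mu=\prod_{i\ge 1} i^{m_i(\mu)}\, m_i(\mu)!$. The quantity $c_r(\mu)$ is the number of ways to choose $r$ distinct cells from the (Young) diagram of $\mu$ such that at least one cell is chosen from each row. For a polynomial argument, $\binom{Y}{r}=Y(Y-1)\cdots(Y-r+1)/r!$; and $\binom{n+s-1}{n-r}=0$ when $n-r<0$. *)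

theory Defs
  imports "HOL-Computational_Algebra.Polynomial"
begin

definition partitions_of :: "nat \<Rightarrow> nat list set" where
  "partitions_of n = {\<mu>. sorted_wrt (\<ge>) \<mu> \<and> (\<forall>k\<in>set \<mu>. 0 < k) \<and> sum_list \<mu> = n}"

text \<open>The sums over partitions are over a finite set, so they are not void by convention.\<close>

lemma finite_partitions_of: "finite (partitions_of n)"
proof (rule finite_subset)
  have len: "length \<mu> \<le> sum_list \<mu>" if "\<forall>k\<in>set \<mu>. 0 < k" for \<mu> :: "nat list"
    using that by (induction \<mu>) (auto simp: Suc_le_eq)
  show "partitions_of n \<subseteq> {\<mu>. set \<mu> \<subseteq> {..n} \<and> length \<mu> \<le> n}"
    using len by (auto simp: partitions_of_def intro: member_le_sum_list)
  show "finite {\<mu>. set \<mu> \<subseteq> {..n} \<and> length \<mu> \<le> n}"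
    by (rule finite_lists_length_le) simp
qed

text \<open>Rows and columns are numbered from 0.\<close>

definition young_diagram :: "nat list \<Rightarrow> (nat \<times> nat) set" where
  "young_diagram \<mu> = {(i, j). i < length \<mu> \<and> j < \<mu> ! i}"

definition row_choices :: "nat \<Rightarrow> nat list \<Rightarrow> nat" where
  "row_choices r \<mu> =
     card {S. S \<subseteq> young_diagram \<mu> \<and> card S = r \<and> (\<forall>i<length \<mu>. \<exists>j. (i, j) \<in> S)}"

text \<open>Values that are not parts of the partition contribute the factor 1, so the product over
  all positive integers reduces to the one over the parts.\<close>

definition z_partition :: "nat list \<Rightarrow> nat" where
  "z_partition \<mu> = (\<Prod>i\<in>set \<mu>. i ^ count_list \<mu> i * fact (count_list \<mu> i))"

definition poly_binomial :: "rat poly \<Rightarrow> nat \<Rightarrow> rat poly" where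
  "poly_binomial Y r = smult (1 / fact r) (\<Prod>i<r. Y - of_nat i)"

abbreviation X :: "rat poly" where
  "X \<equiv> [:0, 1:]"

end

theory Submission
  imports Defs "HOL-Library.Multiset" "HOL-Library.FuncSet"
    "HOL-Computational_Algebra.Formal_Power_Series"
begin

text \<open>Marking each chosen cell by \<open>y\<close> gives
  \<open>\<Sum>\<^sub>r c\<^sub>r(\<mu>) y\<^sup>r = \<Prod>\<^sub>i ((1 + y)\<^bsup>\<mu>\<^sub>i\<^esup> - 1)\<close>.
  Removing one part \<open>k\<close> from \<open>\<mu>\<close> divides \<open>z\<^sub>\<mu>\<close> by \<open>k m\<^sub>k(\<mu>)\<close>, so a sum over \<open>\<mu>\<close> weighted by
  \<open>\<Sum>\<^sub>i g(\<mu>\<^sub>i)\<close> is a convolution with the unweighted sums. For \<open>g(k) = k\<close> this is a differential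
  equation, which identifies the generating function in \<open>t\<close> of the unweighted sums as
  \<open>((1 - t) / (1 - t (1 + y)))\<^sup>X\<close>. For \<open>g(k) = (k)\<^sub>s\<close> the left-hand side times \<open>y\<^sup>r t\<^sup>n\<close>, summed over \<open>r\<close> and
  \<open>n\<close>, becomes \<open>(s - 1)!\<close> times that function times \<open>(1 - t (1 + y))\<^bsup>-s\<^esup> - (1 - t)\<^bsup>-s\<^esup>\<close>, which is
  expanded in powers of \<open>y\<close>.\<close>

section \<open>Partitions as multisets, and the removal of one part\<close>

text \<open>On multisets, inserting or deleting a part is \<open>add_mset\<close> or a difference,
  with no ordering to restore afterwards.\<close>

definition mset_partitions :: "nat \<Rightarrow> nat multiset set" where
  "mset_partitions n = {M. 0 \<notin># M \<and> sum_mset M = n}"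

definition z_mset :: "nat multiset \<Rightarrow> nat" where
  "z_mset M = (\<Prod>i\<in>set_mset M. i ^ count M i * fact (count M i))"

lemma bij_betw_mset_partitions: "bij_betw mset (partitions_of n) (mset_partitions n)"
proof (rule bij_betw_byWitness[where f' = "\<lambda>M. rev (sorted_list_of_multiset M)"])
  show "\<forall>\<mu>\<in>partitions_of n. rev (sorted_list_of_multiset (mset \<mu>)) = \<mu>"
  proof
    fix \<mu> assume "\<mu> \<in> partitions_of n"
    then have "sorted (rev \<mu>)"
      by (simp add: partitions_of_def sorted_wrt_rev)
    then have "sort \<mu> = rev \<mu>"
      by (intro properties_for_sort) auto
    then show "rev (sorted_list_of_multiset (mset \<mu>)) = \<mu>"
      by simp
  qed
  show "\<forall>M\<in>mset_partitions n. mset (rev (sorted_list_of_multiset M)) = M"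
    by simp
  show "mset ` partitions_of n \<subseteq> mset_partitions n"
    by (auto simp: partitions_of_def mset_partitions_def sum_mset_sum_list)
  have "sum_list (rev (sorted_list_of_multiset M)) = sum_mset M" for M :: "nat multiset"
    by (simp flip: sum_mset_sum_list)
  then show "(\<lambda>M. rev (sorted_list_of_multiset M)) ` mset_partitions n \<subseteq> partitions_of n"
    by (auto simp: partitions_of_def mset_partitions_def sorted_wrt_rev intro!: gr0I)
qed

lemma finite_mset_partitions: "finite (mset_partitions n)"
  using bij_betw_finite[OF bij_betw_mset_partitions] finite_partitions_of by blast

lemma z_mset_mset: "z_mset (mset \<mu>) = z_partition \<mu>"
  by (simp add: z_mset_def z_partition_def count_mset)

text \<open>Only the factor at \<open>k\<close> changes: with \<open>m = count N k\<close>, it grows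
  from \<open>k^m * m!\<close> to \<open>k^(m+1) * (m+1)!\<close>.\<close>

lemma z_mset_add: "z_mset (add_mset k N) = k * Suc (count N k) * z_mset N"
proof -
  \<comment> \<open>For \<open>k\<close> not in \<open>M\<close> the factor at \<open>k\<close> is
    1, so one splitting serves both \<open>N\<close> and \<open>add_mset k N\<close>, whether or not
    \<open>k\<close> occurs in \<open>N\<close>.\<close>
  have split: "z_mset M = k ^ count M k * fact (count M k)
      * (\<Prod>i\<in>set_mset N - {k}. i ^ count M i * fact (count M i))"
    if "set_mset M = set_mset N \<or> set_mset M = insert k (set_mset N)" for M
  proof (cases "k \<in># M")
    case True
    moreover have "set_mset M - {k} = set_mset N - {k}" using that by auto
    ultimately show ?thesis by (simp add: z_mset_def prod.remove[of "set_mset M" k])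
  next
    case False
    then have "set_mset M = set_mset N - {k}" using that by auto
    moreover have "count M k = 0" using False by (simp add: not_in_iff)
    ultimately show ?thesis by (simp add: z_mset_def)
  qed
  have "(\<Prod>i\<in>set_mset N - {k}. i ^ count (add_mset k N) i * fact (count (add_mset k N) i))
      = (\<Prod>i\<in>set_mset N - {k}. i ^ count N i * fact (count N i))"
    by (intro prod.cong) auto
  then show ?thesis
    using split[of "add_mset k N"] split[of N] by (simp add: algebra_simps)
qed

lemma z_mset_pos: "0 \<notin># M \<Longrightarrow> z_mset M > 0"
  by (auto simp: z_mset_def intro!: prod_pos gr0I)

text \<open>Pairs of a partition \<open>M\<close> and a value \<open>k\<close> occurring in it
  correspond to pairs of \<open>k\<close> and the remaining partition \<open>N\<close>. The
  multiplicity of \<open>k\<close> in \<open>M\<close> cancels against the same factor in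
  \<open>z_mset_add\<close>, which leaves the denominator \<open>k\<close>.\<close>

lemma sum_mset_partitions_remove_part:
  fixes g w :: "nat \<Rightarrow> 'a::field_char_0"
  shows "(\<Sum>M\<in>mset_partitions n. (\<Sum>k\<in>#M. g k) * (\<Prod>k\<in>#M. w k) / of_nat (z_mset M))
    = (\<Sum>k=1..n. g k * w k / of_nat k
        * (\<Sum>N\<in>mset_partitions (n - k). (\<Prod>j\<in>#N. w j) / of_nat (z_mset N)))"
proof -
  \<comment> \<open>Grouping equal parts makes the multiplicity \<open>count M k\<close> explicit,
    ready to be cancelled.\<close>
  have "(\<Sum>k\<in>#M. g k) = (\<Sum>k\<in>set_mset M. of_nat (count M k) * g k)" for M
  proof (induction M)
    case (add x M)
    show ?case
    proof (cases "x \<in># M")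
      case True
      then show ?thesis
        by (simp add: add.IH insert_absorb sum.remove[of "set_mset M" x] algebra_simps)
    next
      case False
      then have "count M x = 0" by (simp add: not_in_iff)
      moreover have "(\<Sum>k\<in>set_mset M. of_nat (count (add_mset x M) k) * g k)
          = (\<Sum>k\<in>set_mset M. of_nat (count M k) * g k)"
        using False by (intro sum.cong) auto
      ultimately show ?thesis
        using False by (simp add: add.IH)
    qed
  qed simp
  then have "(\<Sum>M\<in>mset_partitions n. (\<Sum>k\<in>#M. g k) * (\<Prod>k\<in>#M. w k) / of_nat (z_mset M))
    = (\<Sum>M\<in>mset_partitions n. \<Sum>k\<in>set_mset M.
        of_nat (count M k) * g k * (\<Prod>k\<in>#M. w k) / of_nat (z_mset M))"
    by (simp add: sum_distrib_right sum_divide_distrib)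
  also have "\<dots> = (\<Sum>(M, k)\<in>Sigma (mset_partitions n) set_mset.
        of_nat (count M k) * g k * (\<Prod>k\<in>#M. w k) / of_nat (z_mset M))"
    by (rule sum.Sigma) (simp_all add: finite_mset_partitions)
  also have "\<dots> = (\<Sum>(k, N)\<in>Sigma {1..n} (\<lambda>k. mset_partitions (n - k)).
        g k * w k / of_nat k * ((\<Prod>j\<in>#N. w j) / of_nat (z_mset N)))"
  proof (rule sum.reindex_bij_witness[where i = "\<lambda>(k, N). (add_mset k N, k)"
        and j = "\<lambda>(M, k). (k, M - {#k#})"], goal_cases)
    case (2 p)
    then obtain M k where p: "p = (M, k)" "M \<in> mset_partitions n" "k \<in># M" by auto
    then obtain N where M: "M = add_mset k N" by (metis insert_DiffM)
    with p show ?case by (auto simp: mset_partitions_def Suc_le_eq)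
  next
    case (5 p)
    then obtain M k where p: "p = (M, k)" "M \<in> mset_partitions n" "k \<in># M" by auto
    then obtain N where M: "M = add_mset k N" by (metis insert_DiffM)
    have "k > 0" "z_mset N > 0"
      using p M by (auto simp: mset_partitions_def intro!: z_mset_pos)
    then show ?case
      by (simp add: p M z_mset_add divide_simps del: of_nat_Suc mult_Suc mult_Suc_right)
  qed (auto simp: mset_partitions_def)
  also have "\<dots> = (\<Sum>k=1..n. g k * w k / of_nat k
        * (\<Sum>N\<in>mset_partitions (n - k). (\<Prod>j\<in>#N. w j) / of_nat (z_mset N)))"
    by (simp add: sum.Sigma[symmetric] finite_mset_partitions sum_distrib_left)
  finally show ?thesis .
qed

section \<open>Choices of cells that meet every row\<close>

lemma young_diagram_eq_Sigma: "young_diagram \<mu> = (SIGMA i:{..<length \<mu>}. {..<\<mu> ! i})"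
  by (auto simp: young_diagram_def)

lemma card_subset_young_diagram:
  assumes "S \<subseteq> young_diagram \<mu>"
  shows "card S \<le> sum_list \<mu>"
proof -
  have "card S \<le> card (young_diagram \<mu>)"
    using assms by (intro card_mono) (simp_all add: young_diagram_eq_Sigma)
  also have "\<dots> = sum_list \<mu>"
    by (simp add: young_diagram_eq_Sigma sum_list_sum_nth atLeast0LessThan)
  finally show ?thesis .
qed

lemma sum_Pow_power_card:
  fixes y :: "'a::comm_semiring_1"
  assumes "finite A"
  shows "(\<Sum>T\<in>Pow A. y ^ card T) = (1 + y) ^ card A"
  using prod_add[OF assms, of "\<lambda>_. y" "\<lambda>_. 1"] by (simp add: add.commute)

text \<open>An admissible set of cells is an independent choice of a nonempty subset of each row,
  and a row of length \<open>k\<close> contributes \<open>(1 + y)^k - 1\<close>, the term for the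
  empty subset being removed.\<close>

lemma row_choices_generating_function:
  fixes y :: "'a::comm_ring_1"
  shows "(\<Sum>r\<le>sum_list \<mu>. of_nat (row_choices r \<mu>) * y ^ r) = (\<Prod>k\<leftarrow>\<mu>. (1 + y) ^ k - 1)"
proof -
  let ?I = "{..<length \<mu>}"
  let ?B = "\<lambda>i. Pow {..<\<mu> ! i} - {{}}"
  let ?C = "{S. S \<subseteq> young_diagram \<mu> \<and> (\<forall>i<length \<mu>. \<exists>j. (i, j) \<in> S)}"
  have finC: "finite ?C"
    by (rule finite_subset[of _ "Pow (young_diagram \<mu>)"]) (auto simp: young_diagram_eq_Sigma)
  have "(\<Prod>k\<leftarrow>\<mu>. (1 + y) ^ k - 1) = (\<Prod>i\<in>?I. (1 + y) ^ (\<mu> ! i) - 1)"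
    by (simp add: prod.list_conv_set_nth atLeast0LessThan)
  also have "\<dots> = (\<Prod>i\<in>?I. \<Sum>T\<in>?B i. y ^ card T)"
    by (intro prod.cong refl) (simp add: sum_diff sum_Pow_power_card)
  also have "\<dots> = (\<Sum>f\<in>PiE ?I ?B. \<Prod>i\<in>?I. y ^ card (f i))"
    by (rule prod_sum_PiE) auto
  also have "\<dots> = (\<Sum>S\<in>?C. y ^ card S)"
  \<comment> \<open>A family of row subsets is glued together by \<open>Sigma\<close>. The inverse
    takes row slices, restricted to valid indices so that the function is extensional.\<close>
  proof (rule sum.reindex_bij_witness[where i = "\<lambda>S. \<lambda>i\<in>?I. S `` {i}" and j = "Sigma ?I"],
      goal_cases)
    case (1 f)
    then show ?case by (auto simp: fun_eq_iff PiE_iff extensional_def)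
  next
    case (2 f)
    then have *: "f i \<subseteq> {..<\<mu> ! i}" "f i \<noteq> {}" if "i < length \<mu>" for i
      using that by (auto simp: PiE_iff)
    have "\<exists>j. (i, j) \<in> Sigma ?I f" if "i < length \<mu>" for i
      using *[OF that] that by auto
    moreover have "Sigma ?I f \<subseteq> young_diagram \<mu>"
      using * by (auto simp: young_diagram_eq_Sigma)
    ultimately show ?case by blast
  next
    case (3 S)
    then show ?case by (auto simp: young_diagram_eq_Sigma)
  next
    case (4 S)
    then show ?case by (auto simp: young_diagram_eq_Sigma PiE_iff)
  next
    case (5 f)
    then have "finite (f i)" if "i < length \<mu>" for i
      using that by (auto simp: PiE_iff intro: finite_subset)
    then show ?case by (simp add: power_sum)
  qed
  also have "\<dots> = (\<Sum>r\<le>sum_list \<mu>. \<Sum>S\<in>{S\<in>?C. card S = r}. y ^ card S)"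
    using finC card_subset_young_diagram by (intro sum.group[symmetric]) auto
  also have "\<dots> = (\<Sum>r\<le>sum_list \<mu>. of_nat (row_choices r \<mu>) * y ^ r)"
    by (intro sum.cong refl) (simp add: row_choices_def conj_ac)
  finally show ?thesis ..
qed

lemma row_choices_eq_0:
  assumes "r > sum_list \<mu>"
  shows "row_choices r \<mu> = 0"
proof -
  have "{S. S \<subseteq> young_diagram \<mu> \<and> card S = r \<and> (\<forall>i<length \<mu>. \<exists>j. (i, j) \<in> S)} = {}"
    using assms card_subset_young_diagram[of _ \<mu>] by (auto simp: not_le[symmetric])
  then show ?thesis unfolding row_choices_def by (simp only: card.empty)
qed

section \<open>Series for negative powers\<close>

text \<open>The expansion of \<open>(1 - a t)\<^bsup>-c\<^esup>\<close> in \<open>t\<close>.\<close>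

definition neg_binomial_series :: "'a::field_char_0 \<Rightarrow> 'a \<Rightarrow> 'a fps" where
  "neg_binomial_series c a = Abs_fps (\<lambda>n. pochhammer c n / fact n * a ^ n)"

text \<open>Vandermonde convolution divided by \<open>fact n\<close>, which is the shape of a Cauchy
  product of negative binomial coefficients.\<close>

lemma pochhammer_Vandermonde:
  fixes c d :: "'a::field_char_0"
  shows "(\<Sum>k\<le>n. pochhammer c k / fact k * (pochhammer d (n - k) / fact (n - k)))
    = pochhammer (c + d) n / fact n"
proof -
  have "pochhammer (c + d) n / fact n
      = (\<Sum>k\<le>n. of_nat (n choose k) * pochhammer c k * pochhammer d (n - k) / fact n)"
    by (simp add: pochhammer_binomial_sum sum_divide_distrib)
  also have "\<dots> = (\<Sum>k\<le>n. pochhammer c k / fact k * (pochhammer d (n - k) / fact (n - k)))"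
    by (intro sum.cong refl) (simp add: binomial_fact)
  finally show ?thesis ..
qed

lemma neg_binomial_series_add:
  "neg_binomial_series c a * neg_binomial_series d a = neg_binomial_series (c + d) a"
proof (rule fps_ext)
  fix n
  have "fps_nth (neg_binomial_series c a * neg_binomial_series d a) n
    = (\<Sum>k\<le>n. pochhammer c k / fact k * (pochhammer d (n - k) / fact (n - k)) * (a ^ k * a ^ (n - k)))"
    by (simp add: fps_mult_nth neg_binomial_series_def atLeast0AtMost mult_ac)
  also have "\<dots> = (\<Sum>k\<le>n. pochhammer c k / fact k * (pochhammer d (n - k) / fact (n - k)) * a ^ n)"
    by (intro sum.cong refl) (simp flip: power_add)
  also have "\<dots> = fps_nth (neg_binomial_series (c + d) a) n"
    by (simp only: sum_distrib_right[symmetric] pochhammer_Vandermonde neg_binomial_series_def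
        fps_nth_Abs_fps)
  finally show "fps_nth (neg_binomial_series c a * neg_binomial_series d a) n
      = fps_nth (neg_binomial_series (c + d) a) n" .
qed

text \<open>The logarithmic derivative of \<open>(1 - a t)^(-c)\<close>, times \<open>t\<close>, is
  \<open>c a t / (1 - a t)\<close>, and \<open>a t / (1 - a t) = 1 / (1 - a t) - 1\<close>.\<close>

lemma X_deriv_neg_binomial_series:
  "fps_X * fps_deriv (neg_binomial_series c a)
    = fps_const c * (neg_binomial_series 1 a - 1) * neg_binomial_series c a"
proof -
  have "fps_X * fps_deriv (neg_binomial_series c a)
      = fps_const (c * a) * fps_X * neg_binomial_series (1 + c) a"
  proof (rule fps_ext)
    fix n
    show "fps_nth (fps_X * fps_deriv (neg_binomial_series c a)) n
        = fps_nth (fps_const (c * a) * fps_X * neg_binomial_series (1 + c) a) n"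
      by (cases n) (simp_all add: neg_binomial_series_def mult.assoc pochhammer_rec add.commute
          field_simps del: of_nat_Suc)
  qed
  also have "neg_binomial_series (1 + c) a = neg_binomial_series 1 a * neg_binomial_series c a"
    by (simp add: neg_binomial_series_add)
  also have "fps_const (c * a) * fps_X * (neg_binomial_series 1 a * neg_binomial_series c a)
      = fps_const c * (fps_const a * (fps_X * neg_binomial_series 1 a)) * neg_binomial_series c a"
    by (simp add: mult_ac flip: fps_const_mult)
  also have "fps_const a * (fps_X * neg_binomial_series 1 a) = neg_binomial_series 1 a - 1"
  proof (rule fps_ext)
    fix n
    show "fps_nth (fps_const a * (fps_X * neg_binomial_series 1 a)) n
        = fps_nth (neg_binomial_series 1 a - 1) n"
      by (cases n) (simp_all add: neg_binomial_series_def flip: pochhammer_fact)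
  qed
  finally show ?thesis .
qed

section \<open>The generating function of the unweighted sums\<close>

text \<open>Since \<open>W\<close> has no constant term, the equation expresses \<open>n\<close>
  times the \<open>n\<close>-th coefficient through earlier ones, and \<open>n > 0\<close> is
  invertible in characteristic 0. The constant term thus determines the series.\<close>

lemma fps_log_deriv_unique:
  fixes F G W :: "'a::field_char_0 fps"
  assumes F: "fps_X * fps_deriv F = W * F" and G: "fps_X * fps_deriv G = W * G"
    and W0: "fps_nth W 0 = 0" and FG: "fps_nth F 0 = fps_nth G 0"
  shows "F = G"
proof (rule fps_ext)
  have coeff: "of_nat n * fps_nth H n = (\<Sum>k=1..n. fps_nth W k * fps_nth H (n - k))"
    if "fps_X * fps_deriv H = W * H" for H n
  proof -
    have "of_nat n * fps_nth H n = fps_nth (fps_X * fps_deriv H) n"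
      by (cases n) simp_all
    also have "\<dots> = (\<Sum>k=0..n. fps_nth W k * fps_nth H (n - k))"
      by (simp add: that fps_mult_nth)
    also have "\<dots> = (\<Sum>k=1..n. fps_nth W k * fps_nth H (n - k))"
      by (simp add: sum.atLeast_Suc_atMost W0)
    finally show ?thesis .
  qed
  fix n
  show "fps_nth F n = fps_nth G n"
  proof (induction n rule: less_induct)
    case (less n)
    show ?case
    proof (cases "n = 0")
      case False
      have "of_nat n * fps_nth F n = of_nat n * fps_nth G n"
        unfolding coeff[OF F] coeff[OF G] by (intro sum.cong refl) (simp add: less)
      with False show ?thesis by simp
    qed (simp add: FG)
  qed
qed

text \<open>Both sides have constant term 1 and solve \<open>t F' = W F\<close> with
  \<open>W = x (1 / (1 - a t) - 1 / (1 - t))\<close>.\<close>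

lemma cycle_index_generating_function:
  fixes x a :: "'a::field_char_0"
  shows "Abs_fps (\<lambda>n. \<Sum>M\<in>mset_partitions n. (\<Prod>k\<in>#M. x * (a ^ k - 1)) / of_nat (z_mset M))
    = neg_binomial_series x a * neg_binomial_series (- x) 1" (is "?H = ?A * ?B")
proof (rule fps_log_deriv_unique)
  let ?w = "\<lambda>k. x * (a ^ k - 1)"
  let ?W = "Abs_fps ?w"
  have W: "?W = fps_const x * (neg_binomial_series 1 a - neg_binomial_series 1 1)"
    by (rule fps_ext) (simp add: neg_binomial_series_def flip: pochhammer_fact)
  show "fps_X * fps_deriv ?H = ?W * ?H"
  proof (rule fps_ext)
    fix n
    have "fps_nth (fps_X * fps_deriv ?H) n = of_nat n * fps_nth ?H n"
      by (cases n) simp_all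
    \<comment> \<open>The factor \<open>n\<close> is the sum of the parts of \<open>M\<close>. As a
      weight it cancels the denominator \<open>k\<close> left by removing a part.\<close>
    also have "\<dots> = (\<Sum>M\<in>mset_partitions n.
        (\<Sum>k\<in>#M. of_nat k) * (\<Prod>k\<in>#M. ?w k) / of_nat (z_mset M))"
      by (simp add: sum_distrib_left mset_partitions_def flip: of_nat_sum_mset)
    also have "\<dots> = (\<Sum>k=1..n. ?w k * fps_nth ?H (n - k))"
      by (subst sum_mset_partitions_remove_part) (auto intro!: sum.cong)
    also have "\<dots> = fps_nth (?W * ?H) n"
      by (simp add: fps_mult_nth sum.atLeast_Suc_atMost)
    finally show "fps_nth (fps_X * fps_deriv ?H) n = fps_nth (?W * ?H) n" .
  qed
  have "fps_X * fps_deriv (?A * ?B) = (fps_X * fps_deriv ?A) * ?B + ?A * (fps_X * fps_deriv ?B)"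
    by (simp add: algebra_simps)
  also have "\<dots> = ?W * (?A * ?B)"
    unfolding X_deriv_neg_binomial_series W
    by (simp add: algebra_simps flip: fps_const_neg)
  finally show "fps_X * fps_deriv (?A * ?B) = ?W * (?A * ?B)" .
  have "mset_partitions 0 = {{#}}"
    by (auto simp: mset_partitions_def) (metis multiset_nonemptyE)
  then show "fps_nth ?H 0 = fps_nth (?A * ?B) 0"
    by (simp add: neg_binomial_series_def z_mset_def)
qed simp

section \<open>Expansion in \<open>y\<close> and the weighted sums\<close>

text \<open>As series in \<open>t\<close>, this is the factorisation
  \<open>1 - t (1 + y) = (1 - t) (1 - v)\<close> with \<open>v = t y / (1 - t)\<close>.\<close>

lemma neg_binomial_series_mult_nth_expand:
  fixes c d y :: "'a::field_char_0"
  shows "fps_nth (neg_binomial_series c (1 + y) * neg_binomial_series d 1) n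
    = (\<Sum>r\<le>n. pochhammer c r / fact r * (pochhammer (c + d + of_nat r) (n - r) / fact (n - r)) * y ^ r)"
proof -
  let ?D = "\<lambda>m. pochhammer d m / fact m"
  \<comment> \<open>The rising factorial of length \<open>k\<close> splits at \<open>r\<close>,
    while the binomial coefficient replaces \<open>1 / k!\<close> by
    \<open>1 / (r! (k - r)!)\<close>.\<close>
  have revision: "pochhammer c k / fact k * of_nat (k choose r)
      = pochhammer c r / fact r * (pochhammer (c + of_nat r) (k - r) / fact (k - r))" if "r \<le> k" for k r
    using that by (simp add: binomial_fact pochhammer_product[of r k c])
  have "fps_nth (neg_binomial_series c (1 + y) * neg_binomial_series d 1) n
      = (\<Sum>k\<le>n. pochhammer c k / fact k * (y + 1) ^ k * ?D (n - k))"
    by (simp add: fps_mult_nth neg_binomial_series_def atLeast0AtMost add.commute)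
  also have "\<dots> = (\<Sum>k\<le>n. \<Sum>r\<le>k. pochhammer c k / fact k * of_nat (k choose r) * y ^ r * ?D (n - k))"
    by (simp add: binomial_ring sum_distrib_left sum_distrib_right sum_divide_distrib mult.assoc)
  also have "\<dots> = (\<Sum>k\<le>n. \<Sum>r\<le>k. pochhammer c r / fact r
      * (pochhammer (c + of_nat r) (k - r) / fact (k - r) * ?D (n - k)) * y ^ r)"
    by (intro sum.cong refl) (simp only: revision atMost_iff, simp only: mult_ac)
  also have "\<dots> = (\<Sum>r\<le>n. \<Sum>k\<in>{r..n}. pochhammer c r / fact r
      * (pochhammer (c + of_nat r) (k - r) / fact (k - r) * ?D (n - k)) * y ^ r)"
    by (simp only: sum.Sigma finite_atMost finite_atLeastAtMost ball_triv simp_thms)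
      (rule sum.reindex_bij_witness[where i = "\<lambda>(r, k). (k, r)" and j = "\<lambda>(k, r). (r, k)"], auto)
  also have "\<dots> = (\<Sum>r\<le>n. pochhammer c r / fact r
      * (\<Sum>k\<in>{r..n}. pochhammer (c + of_nat r) (k - r) / fact (k - r) * ?D (n - k)) * y ^ r)"
    by (simp only: sum_distrib_left sum_distrib_right)
  also have "\<dots> = (\<Sum>r\<le>n. pochhammer c r / fact r
      * (pochhammer (c + d + of_nat r) (n - r) / fact (n - r)) * y ^ r)"
  proof (intro sum.cong refl)
    fix r assume "r \<in> {..n}"
    then have "(\<Sum>k\<in>{r..n}. pochhammer (c + of_nat r) (k - r) / fact (k - r) * ?D (n - k))
        = (\<Sum>k\<le>n - r. pochhammer (c + of_nat r) k / fact k * ?D (n - r - k))"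
      by (intro sum.reindex_bij_witness[where i = "\<lambda>k. k + r" and j = "\<lambda>k. k - r"]) auto
    \<comment> \<open>Vandermonde with parameters \<open>c + r\<close> and \<open>d\<close>
      collapses the sum over \<open>k\<close>.\<close>
    also have "\<dots> = pochhammer (c + d + of_nat r) (n - r) / fact (n - r)"
      by (subst pochhammer_Vandermonde) (simp add: add_ac)
    finally show "pochhammer c r / fact r
        * (\<Sum>k\<in>{r..n}. pochhammer (c + of_nat r) (k - r) / fact (k - r) * ?D (n - k)) * y ^ r
      = pochhammer c r / fact r * (pochhammer (c + d + of_nat r) (n - r) / fact (n - r)) * y ^ r"
      by simp
  qed
  finally show ?thesis .
qed

lemma fact_mult_pochhammer_Suc:
  "fact m * pochhammer (of_nat (Suc m)) j = (fact (m + j) :: 'a::{comm_semiring_1,semiring_char_0})"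
  by (simp add: pochhammer_fact pochhammer_product')

text \<open>After exponents are merged, two products remain, with parameters
  \<open>(s + x, -x)\<close> and \<open>(x, s - x)\<close>. Both pairs add up to \<open>s\<close>,
  so their expansions share one binomial factor and differ only in the rising factorials
  \<open>(x + s)_r\<close> and \<open>(x)_r\<close>.\<close>

lemma weighted_mset_partition_sum:
  fixes x y :: "'a::field_char_0"
  assumes "s \<ge> 1"
  shows "(\<Sum>M\<in>mset_partitions n. (\<Sum>k\<in>#M. pochhammer (of_nat k) s)
      * (\<Prod>k\<in>#M. x * ((1 + y) ^ k - 1)) / of_nat (z_mset M))
    = (\<Sum>r\<le>n. x * fact (s - 1) * of_nat ((n + s - 1) choose (n - r))
        * (pochhammer (x + of_nat s) r - pochhammer x r) / fact r * y ^ r)"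
proof -
  let ?bs = "\<lambda>c. neg_binomial_series c (1 + y)" and ?b1 = "\<lambda>c. neg_binomial_series c 1"
  let ?H = "?bs x * ?b1 (- x)"
  obtain s' where s: "s = Suc s'" using assms by (cases s) auto
  \<comment> \<open>Both \<open>(k)_s / k\<close> and \<open>(s - 1)! (s)_k / k!\<close> equal
    \<open>(k + s - 1)! / k!\<close>. This turns the weight in \<open>k\<close> into a coefficient
    of a negative power.\<close>
  have part_weight: "pochhammer (of_nat k) s * (x * ((1 + y) ^ k - 1)) / of_nat k
      = x * fact (s - 1) * fps_nth (?bs (of_nat s) - ?b1 (of_nat s)) k" if k: "k \<in> {1..n}" for k
  proof -
    obtain m where m: "k = Suc m" using k by (cases k) auto
    have "fact m * pochhammer (of_nat k) s = (fact (m + s) :: 'a)"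
      unfolding m by (rule fact_mult_pochhammer_Suc)
    moreover have "fact (s - 1) * pochhammer (of_nat s) k = (fact (m + s) :: 'a)"
      unfolding s diff_Suc_1 by (subst fact_mult_pochhammer_Suc) (simp add: m add_ac)
    moreover have "(fact k :: 'a) = of_nat k * fact m"
      by (simp add: m)
    ultimately have "pochhammer (of_nat k) s / of_nat k
        = fact (s - 1) * (pochhammer (of_nat s) k / fact k :: 'a)"
      using m by (simp add: field_simps del: of_nat_Suc fact_Suc)
    then have "pochhammer (of_nat k) s / of_nat k * (x * ((1 + y) ^ k - 1))
        = fact (s - 1) * (pochhammer (of_nat s) k / fact k) * (x * ((1 + y) ^ k - 1))"
      by (simp only:)
    moreover have "fps_nth (?bs (of_nat s) - ?b1 (of_nat s)) k
        = pochhammer (of_nat s) k / fact k * ((1 + y) ^ k - 1)"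
      by (simp add: neg_binomial_series_def right_diff_distrib)
    ultimately show ?thesis
      by (simp only: times_divide_eq_left times_divide_eq_right mult_ac)
  qed
  have "(\<Sum>M\<in>mset_partitions n. (\<Sum>k\<in>#M. pochhammer (of_nat k) s)
      * (\<Prod>k\<in>#M. x * ((1 + y) ^ k - 1)) / of_nat (z_mset M))
    = (\<Sum>k=1..n. pochhammer (of_nat k) s * (x * ((1 + y) ^ k - 1)) / of_nat k * fps_nth ?H (n - k))"
    by (simp only: sum_mset_partitions_remove_part fps_nth_Abs_fps
        flip: cycle_index_generating_function)
  also have "\<dots> = (\<Sum>k=1..n. x * fact (s - 1)
      * (fps_nth (?bs (of_nat s) - ?b1 (of_nat s)) k * fps_nth ?H (n - k)))"
    by (intro sum.cong refl) (simp only: part_weight mult.assoc)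
  \<comment> \<open>The term \<open>k = 0\<close> may be added because both series start with
    1.\<close>
  also have "\<dots> = x * fact (s - 1)
      * (\<Sum>k=0..n. fps_nth (?bs (of_nat s) - ?b1 (of_nat s)) k * fps_nth ?H (n - k))"
    by (simp add: sum.atLeast_Suc_atMost[of 0 n] neg_binomial_series_def flip: sum_distrib_left)
  also have "\<dots> = x * fact (s - 1) * fps_nth ((?bs (of_nat s) - ?b1 (of_nat s)) * ?H) n"
    by (simp only: fps_mult_nth)
  also have "(?bs (of_nat s) - ?b1 (of_nat s)) * ?H
      = (?bs (of_nat s) * ?bs x) * ?b1 (- x) - ?bs x * (?b1 (of_nat s) * ?b1 (- x))"
    by (simp add: algebra_simps)
  also have "\<dots> = ?bs (of_nat s + x) * ?b1 (- x) - ?bs x * ?b1 (of_nat s + - x)"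
    by (simp only: neg_binomial_series_add)
  also have "x * fact (s - 1) * fps_nth \<dots> n
    = (\<Sum>r\<le>n. x * fact (s - 1) * (pochhammer (of_nat s + of_nat r) (n - r) / fact (n - r))
        * (pochhammer (x + of_nat s) r - pochhammer x r) / fact r * y ^ r)"
    unfolding fps_sub_nth neg_binomial_series_mult_nth_expand sum_subtractf[symmetric] sum_distrib_left
    by (intro sum.cong refl) (simp add: field_simps)
  also have "\<dots> = (\<Sum>r\<le>n. x * fact (s - 1) * of_nat ((n + s - 1) choose (n - r))
        * (pochhammer (x + of_nat s) r - pochhammer x r) / fact r * y ^ r)"
  proof -
    \<comment> \<open>Both sides are \<open>(n + s - 1)! / ((s + r - 1)! (n - r)!)\<close>.\<close>
    have "pochhammer (of_nat s + of_nat r) (n - r) / fact (n - r)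
        = (of_nat ((n + s - 1) choose (n - r)) :: 'a)" if "r \<le> n" for r
    proof -
      have "fact (s' + r) * pochhammer (of_nat s + of_nat r) (n - r) = (fact (n + s') :: 'a)"
        using fact_mult_pochhammer_Suc[of "s' + r" "n - r", where ?'a = 'a] that
        by (simp add: s add_ac)
      moreover have "n + s' - (n - r) = s' + r" using that by simp
      ultimately show ?thesis
        by (simp add: s binomial_fact field_simps)
    qed
    then show ?thesis by (intro sum.cong refl) (simp only: atMost_iff)
  qed
  finally show ?thesis .
qed

section \<open>Comparison of coefficients and the polynomial identity\<close>

text \<open>For fixed \<open>x\<close>, the two sides are the coefficients of \<open>y^r\<close> in
  polynomials that agree at every \<open>y\<close> of an infinite field.\<close>

lemma partition_sum_eval:
  fixes x :: "'a::field_char_0"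
  assumes "s \<ge> 1" and "r \<le> n"
  shows "(\<Sum>\<mu>\<in>partitions_of n. of_nat (row_choices r \<mu>) / of_nat (z_partition \<mu>) * x ^ length \<mu>
      * of_nat (\<Sum>i<length \<mu>. pochhammer (\<mu> ! i) s))
    = x * fact (s - 1) * of_nat ((n + s - 1) choose (n - r))
        * (pochhammer (x + of_nat s) r - pochhammer x r) / fact r"
    (is "?L r = ?R r")
proof -
  have "(\<Sum>r\<le>n. ?L r * y ^ r) = (\<Sum>r\<le>n. ?R r * y ^ r)" for y
  proof -
    have "(\<Sum>r\<le>n. ?L r * y ^ r) = (\<Sum>\<mu>\<in>partitions_of n. \<Sum>r\<le>n.
        of_nat (\<Sum>i<length \<mu>. pochhammer (\<mu> ! i) s) * x ^ length \<mu> / of_nat (z_partition \<mu>)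
          * (of_nat (row_choices r \<mu>) * y ^ r))"
      unfolding sum_distrib_right by (subst sum.swap) (simp add: mult_ac)
    also have "\<dots> = (\<Sum>\<mu>\<in>partitions_of n. (\<Sum>k\<in>#mset \<mu>. pochhammer (of_nat k) s)
      * (\<Prod>k\<in>#mset \<mu>. x * ((1 + y) ^ k - 1)) / of_nat (z_mset (mset \<mu>)))"
    proof (rule sum.cong[OF refl])
      fix \<mu> assume "\<mu> \<in> partitions_of n"
      \<comment> \<open>The cutoff \<open>r \<le> n\<close> is thus the number of cells, as
        \<open>row_choices_generating_function\<close> requires.\<close>
      then have n: "n = sum_list \<mu>" by (simp add: partitions_of_def)
      have "(\<Sum>r\<le>n. of_nat (\<Sum>i<length \<mu>. pochhammer (\<mu> ! i) s) * x ^ length \<mu>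
            / of_nat (z_partition \<mu>) * (of_nat (row_choices r \<mu>) * y ^ r))
          = of_nat (\<Sum>i<length \<mu>. pochhammer (\<mu> ! i) s) * x ^ length \<mu>
            / of_nat (z_partition \<mu>) * (\<Prod>k\<leftarrow>\<mu>. (1 + y) ^ k - 1)"
        by (simp only: n row_choices_generating_function flip: sum_distrib_left)
      moreover have "(\<Prod>k\<in>#mset \<mu>. x * ((1 + y) ^ k - 1))
          = x ^ length \<mu> * (\<Prod>k\<leftarrow>\<mu>. (1 + y) ^ k - 1)"
        by (induction \<mu>) simp_all
      moreover have "(\<Sum>k\<in>#mset \<mu>. pochhammer (of_nat k :: 'a) s)
          = of_nat (\<Sum>i<length \<mu>. pochhammer (\<mu> ! i) s)"
      proof -
        have "(\<Sum>k\<in>#mset \<mu>. pochhammer (of_nat k :: 'a) s) = (\<Sum>k\<leftarrow>\<mu>. pochhammer (of_nat k) s)"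
          by (induction \<mu>) simp_all
        then show ?thesis
          by (simp add: sum_list_sum_nth atLeast0LessThan pochhammer_of_nat)
      qed
      ultimately show "(\<Sum>r\<le>n. of_nat (\<Sum>i<length \<mu>. pochhammer (\<mu> ! i) s) * x ^ length \<mu>
            / of_nat (z_partition \<mu>) * (of_nat (row_choices r \<mu>) * y ^ r))
          = (\<Sum>k\<in>#mset \<mu>. pochhammer (of_nat k) s)
            * (\<Prod>k\<in>#mset \<mu>. x * ((1 + y) ^ k - 1)) / of_nat (z_mset (mset \<mu>))"
        by (simp only: z_mset_mset) simp
    qed
    also have "\<dots> = (\<Sum>M\<in>mset_partitions n. (\<Sum>k\<in>#M. pochhammer (of_nat k) s)
      * (\<Prod>k\<in>#M. x * ((1 + y) ^ k - 1)) / of_nat (z_mset M))"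
      by (rule sum.reindex_bij_betw[OF bij_betw_mset_partitions])
    also have "\<dots> = (\<Sum>r\<le>n. ?R r * y ^ r)"
      by (rule weighted_mset_partition_sum[OF assms(1)])
    finally show ?thesis .
  qed
  then have "(\<Sum>r\<le>n. monom (?L r) r) = (\<Sum>r\<le>n. monom (?R r) r)"
    by (intro poly_ext) (simp add: poly_sum poly_monom)
  then have "coeff (\<Sum>r\<le>n. monom (?L r) r) r = coeff (\<Sum>r\<le>n. monom (?R r) r) r"
    by (simp only:)
  with assms(2) show ?thesis
    by (simp only: coeff_sum coeff_monom sum.delta finite_atMost atMost_iff if_True)
qed

text \<open>The falling factorial is read from its smallest factor upwards. For
  \<open>Y = X + r + s - 1\<close> and \<open>Y = X + r - 1\<close> this produces
  \<open>(x + s)_r\<close> and \<open>(x)_r\<close>.\<close>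

lemma poly_poly_binomial:
  "poly (poly_binomial Y r) x = pochhammer (poly Y x - of_nat r + 1) r / fact r"
  by (simp add: poly_binomial_def poly_prod gbinomial_prod_rev atLeast0LessThan
      flip: gbinomial_pochhammer')

theorem mainTheorem1:
  fixes n r s :: nat
  assumes "n \<ge> 1" and "s \<ge> 1"
  shows "(\<Sum>\<mu>\<in>partitions_of n.
            smult (of_nat (row_choices r \<mu>) / of_nat (z_partition \<mu>)) (X ^ (length \<mu> - 1))
              * of_nat (\<Sum>i<length \<mu>. pochhammer (\<mu> ! i) s))
         = fact (s - 1) * of_nat (if r \<le> n then (n + s - 1) choose (n - r) else 0)
             * (poly_binomial (X + of_nat r + of_nat s - 1) r - poly_binomial (X + of_nat r - 1) r)"
    (is "?L = ?R")
proof (cases "r \<le> n")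
  case False
  \<comment> \<open>There are only \<open>n\<close> cells, so for \<open>r > n\<close> both sides
    vanish.\<close>
  then have "row_choices r \<mu> = 0" if "\<mu> \<in> partitions_of n" for \<mu>
    using that by (intro row_choices_eq_0) (simp add: partitions_of_def)
  with False show ?thesis by simp
next
  case True
  \<comment> \<open>The extra factor \<open>X\<close> restores the exponent
    \<open>length \<mu>\<close> of \<open>partition_sum_eval\<close>, and is cancelled at the
    end.\<close>
  have "X * ?L = X * ?R"
  proof (rule poly_ext)
    fix x :: rat
    have "poly (X * ?L) x = (\<Sum>\<mu>\<in>partitions_of n.
        of_nat (row_choices r \<mu>) / of_nat (z_partition \<mu>) * x ^ length \<mu>
          * of_nat (\<Sum>i<length \<mu>. pochhammer (\<mu> ! i) s))"
      unfolding poly_mult poly_sum sum_distrib_left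
    proof (rule sum.cong[OF refl])
      fix \<mu> assume "\<mu> \<in> partitions_of n"
      \<comment> \<open>As \<open>n \<ge> 1\<close>, there is at least one part, and the subtraction
        in \<open>length \<mu> - 1\<close> is not truncated.\<close>
      with assms have "\<mu> \<noteq> []" by (auto simp: partitions_of_def)
      then have "x ^ length \<mu> = x * x ^ (length \<mu> - 1)" by (cases \<mu>) simp_all
      then show "poly X x * (poly (smult (of_nat (row_choices r \<mu>) / of_nat (z_partition \<mu>))
            (X ^ (length \<mu> - 1))) x * poly (of_nat (\<Sum>i<length \<mu>. pochhammer (\<mu> ! i) s)) x)
          = of_nat (row_choices r \<mu>) / of_nat (z_partition \<mu>) * x ^ length \<mu>
            * of_nat (\<Sum>i<length \<mu>. pochhammer (\<mu> ! i) s)"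
        by (simp del: of_nat_sum)
    qed
    also have "\<dots> = x * fact (s - 1) * of_nat ((n + s - 1) choose (n - r))
        * (pochhammer (x + of_nat s) r - pochhammer x r) / fact r"
      using assms(2) True by (rule partition_sum_eval)
    also have "\<dots> = poly (X * ?R) x"
    proof -
      have "poly (fact (s - 1)) x = fact (s - 1)"
        by (metis of_nat_fact poly_of_nat)
      with True show ?thesis
        by (simp add: poly_poly_binomial diff_divide_distrib algebra_simps)
    qed
    finally show "poly (X * ?L) x = poly (X * ?R) x" .
  qed
  then show ?thesis
    by (subst (asm) mult_cancel_left) simp
qed

end
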